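(* Let $\Delta_\theta>0$, $\gamma\in(0,1)$, $\beta>0$, and let $W_{cl}\in\mathbb{R}^{K\times n_q}$ (with rows $w_1^\top,\dots,w_K^\top$) and $b_{cl}\in\mathbb{R}^K$ be the fixed weights and biases of the linear classifier. Suppose the quantum encoding $\theta\mapsto\rho(\theta)$ is Lipschitz in trace distance: there is $L_{\mathrm{enc}}\ge 0$ such that for all $\theta,\theta'$, $$D_{\mathrm{tr}}(\rho(\theta),\rho(\theta'))\le L_{\mathrm{enc}}\|\theta-\theta'\|_2 .$$ Then the randomized region-selection mechanism that maps $\theta$ to the released region index $\tilde k\in\{1,\dots,K\}$ (encode $\theta$, apply the trained circuit unitary, apply the depolarizing channel $\mathcal{E}_\gamma$, compute the Pauli-$Z$ expectation features $h(\theta)$, form the logits $s(\theta)=W_{cl}h(\theta)+b_{cl}$, and sample $\tilde k$ from the softmax distribution with inverse temperature $\beta$) satisfies $(\varepsilon_{\mathrm{reg}},0)$-differential privacy over the output space $\mathcal{Y}=\{1,\dots,K\}$, where $$\varepsilon_{\mathrm{reg}}\le 4\beta(1-\gamma)\,L_{\mathrm{enc}}\,\Delta_\theta\,\|W_{cl}\|_{\infty,1},\qquad \|W_{cl}\|_{\infty,1}:=\max_{k}\|w_k\|_1 .$$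
   Context: **Parameters and adjacency.** Parameters are vectors $\theta$ in a parameter set $\Theta\subset\mathbb{R}^m$. For fixed $\Delta_\theta>0$, two parameters $\theta,\theta'$ are adjacent, written $\theta\sim\theta'$, if $\|\theta-\theta'\|_2\le\Delta_\theta$. **Differential privacy.** A randomized mechanism $\mathcal{M}:\Theta\to\mathcal{Y}$ satisfies $(\varepsilon,0)$-differential privacy if for any adjacent $\theta\sim\theta'$ and any measurable set $S\subseteq\mathcal{Y}$, $\mathbb{P}[\mathcal{M}(\theta)\in S]\le e^{\varepsilon}\,\mathbb{P}[\mathcal{M}(\theta')\in S]$. **Quantum model.** There are $n_q$ qubits, $D=2^{n_q}$, and $I$ is the $D\times D$ identity matrix. Quantum states are density matrices (positive semidefinite, trace one) in $\mathbb{C}^{D\times D}$. For each $\theta$, $\rho(\theta)$ denotes the density matrix of the (pure) state obtained by encoding the input $\theta$ in the circuit. $U(\phi_q)$ is a fixed $D\times D$ unitary with trained parameters $\phi_q$, not depending on $\theta$; the noiseless circuit output state on input $\theta$ is $U(\phi_q)\rho(\theta)U^\dagger(\phi_q)$. The trace distance is $D_{\mathrm{tr}}(\rho,\rho'):=\frac12\|\rho-\rho'\|_1$, where $\|\cdot\|_1$ on matrices is the trace norm (sum of singular values). The depolarizing channel with noise level $\gamma\in(0,1)$ is $$\mathcal{E}_\gamma(\rho)=(1-\gamma)\rho+\gamma\frac{I}{D}.$$ **Features, logits, sampling.** Let $\sigma_z^{(j)}$ be the Pauli-$Z$ operator acting on qubit $j$ (identity on the other qubits). The feature vector $h(\theta)\in\mathbb{R}^{n_q}$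 has coordinates $$h_j(\theta)=\mathrm{Tr}\left(\sigma_z^{(j)}\,\mathcal{E}_\gamma\left(U(\phi_q)\rho(\theta)U^\dagger(\phi_q)\right)\right),\quad j=1,\dots,n_q$$ (exact expectation values). The logits are $s(\theta)=W_{cl}h(\theta)+b_{cl}\in\mathbb{R}^K$, and the released index $\tilde k$ is sampled with $$\mathbb{P}[\tilde k=k\mid\theta]=\frac{\exp(\beta s_k(\theta))}{\sum_{j=1}^K\exp(\beta s_j(\theta))},\quad k=1,\dots,K.$$ For vectors $\|\cdot\|_1$ and $\|\cdot\|_2$ are the usual $\ell_1$ and $\ell_2$ norms. *)

theory Defs
  imports
    "HOL-Probability.Probability"
    "Jordan_Normal_Form.Schur_Decomposition"
begin

unbundle no vec_syntax

section \<open>Differential privacy\<close>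

definition adjacent :: "real \<Rightarrow> real ^ 'm \<Rightarrow> real ^ 'm \<Rightarrow> bool" where
  "adjacent \<Delta> \<theta> \<theta>' \<longleftrightarrow> norm (\<theta> - \<theta>') \<le> \<Delta>"

text \<open>
  A mechanism on the parameter set \<open>\<Theta>\<close> with output space \<open>Y\<close> is represented by its output
  distributions: \<open>M \<theta>\<close> is a probability measure on the measurable space \<open>Y\<close> for each \<open>\<theta> \<in> \<Theta>\<close>.
\<close>

definition pure_dp ::
  "'p set \<Rightarrow> ('p \<Rightarrow> 'p \<Rightarrow> bool) \<Rightarrow> 'y measure \<Rightarrow> ('p \<Rightarrow> 'y measure) \<Rightarrow> real \<Rightarrow> bool" where
  "pure_dp \<Theta> adj Y M \<epsilon> \<longleftrightarrow>
     (\<forall>\<theta>\<in>\<Theta>. M \<theta> \<in> space (prob_algebra Y)) \<and>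
     (\<forall>\<theta>\<in>\<Theta>. \<forall>\<theta>'\<in>\<Theta>. adj \<theta> \<theta>' \<longrightarrow>
        (\<forall>S\<in>sets Y. measure (M \<theta>) S \<le> exp \<epsilon> * measure (M \<theta>') S))"

section \<open>Quantum states and channels\<close>

definition mat_trace :: "'a::comm_monoid_add mat \<Rightarrow> 'a" where
  "mat_trace A = (\<Sum>i<dim_row A. A $$ (i, i))"

definition unitary_mat :: "nat \<Rightarrow> complex mat \<Rightarrow> bool" where
  "unitary_mat d U \<longleftrightarrow>
     U \<in> carrier_mat d d \<and> mat_adjoint U * U = 1\<^sub>m d \<and> U * mat_adjoint U = 1\<^sub>m d"

definition psd_mat :: "nat \<Rightarrow> complex mat \<Rightarrow> bool" where
  "psd_mat d A \<longleftrightarrow>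
     A \<in> carrier_mat d d \<and> mat_adjoint A = A \<and>
     (\<forall>v\<in>carrier_vec d. 0 \<le> Re ((A *\<^sub>v v) \<bullet>c v))"

definition density_mat :: "nat \<Rightarrow> complex mat \<Rightarrow> bool" where
  "density_mat d \<rho> \<longleftrightarrow> psd_mat d \<rho> \<and> mat_trace \<rho> = 1"

text \<open>In Dirac notation, \<open>\<rho> = |\<psi>\<rangle>\<langle>\<psi>|\<close>; the trace condition forces \<open>\<psi>\<close> to be a unit vector.\<close>

definition pure_density_mat :: "nat \<Rightarrow> complex mat \<Rightarrow> bool" where
  "pure_density_mat d \<rho> \<longleftrightarrow>
     density_mat d \<rho> \<and>
     (\<exists>\<psi>\<in>carrier_vec d. \<rho> = mat d d (\<lambda>(i, j). \<psi> $ i * cnj (\<psi> $ j)))"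

text \<open>
  The singular values of a square matrix \<open>A\<close> are the square roots of the eigenvalues of \<open>A\<^sup>*A\<close>,
  counted with algebraic multiplicity. Those eigenvalues are real and nonnegative, so that
  taking real parts loses nothing.
\<close>

definition singular_values :: "complex mat \<Rightarrow> real multiset" where
  "singular_values A = image_mset (\<lambda>e. sqrt (Re e)) (proots (char_poly (mat_adjoint A * A)))"

definition trace_norm :: "complex mat \<Rightarrow> real" where
  "trace_norm A = sum_mset (singular_values A)"

definition trace_distance :: "complex mat \<Rightarrow> complex mat \<Rightarrow> real" where
  "trace_distance \<rho> \<rho>' = 1 / 2 * trace_norm (\<rho> - \<rho>')"

definition depolarizing :: "nat \<Rightarrow> real \<Rightarrow> complex mat \<Rightarrow> complex mat" where
  "depolarizing d \<gamma> \<rho> =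
     complex_of_real (1 - \<gamma>) \<cdot>\<^sub>m \<rho> + (complex_of_real \<gamma> / of_nat d) \<cdot>\<^sub>m 1\<^sub>m d"

definition kron :: "'a::times mat \<Rightarrow> 'a mat \<Rightarrow> 'a mat" where
  "kron A B = mat (dim_row A * dim_row B) (dim_col A * dim_col B)
     (\<lambda>(i, j). A $$ (i div dim_row B, j div dim_col B) * B $$ (i mod dim_row B, j mod dim_col B))"

definition pauli_z :: "complex mat" where
  "pauli_z = mat_of_rows_list 2 [[1, 0], [0, -1]]"

text \<open>Qubits are numbered from 0, so qubit \<open>j < n\<close> has \<open>j\<close> qubits before it and \<open>n - Suc j\<close> after.\<close>

definition pauli_z_on :: "nat \<Rightarrow> nat \<Rightarrow> complex mat" where
  "pauli_z_on n j = kron (kron (1\<^sub>m (2 ^ j)) pauli_z) (1\<^sub>m (2 ^ (n - Suc j)))"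

section \<open>The region-selection mechanism\<close>

text \<open>
  The expectation value is the trace of a product of two Hermitian matrices, hence real;
  \<open>Re\<close> only changes its type.
\<close>

definition features :: "nat \<Rightarrow> real \<Rightarrow> complex mat \<Rightarrow> complex mat \<Rightarrow> real vec" where
  "features n \<gamma> U \<rho> =
     vec n (\<lambda>j. Re (mat_trace (pauli_z_on n j * depolarizing (2 ^ n) \<gamma> (U * \<rho> * mat_adjoint U))))"

definition logits :: "real mat \<Rightarrow> real vec \<Rightarrow> real vec \<Rightarrow> real vec" where
  "logits W b h = W *\<^sub>v h + b"

text \<open>Classes are numbered \<open>1, \<dots>, K\<close>; class \<open>k\<close> has the logit with vector index \<open>k - 1\<close>.\<close>

definition softmax_prob :: "real \<Rightarrow> real vec \<Rightarrow> nat \<Rightarrow> real" where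
  "softmax_prob \<beta> s k =
     exp (\<beta> * s $ (k - 1)) / (\<Sum>j\<in>{1..dim_vec s}. exp (\<beta> * s $ (j - 1)))"

definition region_mechanism ::
  "nat \<Rightarrow> nat \<Rightarrow> real \<Rightarrow> real \<Rightarrow> complex mat \<Rightarrow> real mat \<Rightarrow> real vec \<Rightarrow>
   ('p \<Rightarrow> complex mat) \<Rightarrow> 'p \<Rightarrow> nat measure" where
  "region_mechanism n K \<gamma> \<beta> U W b \<rho> \<theta> =
     point_measure {1..K}
       (\<lambda>k. ennreal (softmax_prob \<beta> (logits W b (features n \<gamma> U (\<rho> \<theta>))) k))"

definition norm_inf_1 :: "real mat \<Rightarrow> real" where
  "norm_inf_1 W = Max ((\<lambda>k. \<Sum>j<dim_col W. \<bar>W $$ (k, j)\<bar>) ` {..<dim_row W})"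

end

theory Submission
  imports Defs "Jordan_Normal_Form.Spectral_Radius"
begin

text \<open>
  The privacy loss is controlled by a chain of Lipschitz estimates, from parameters to states,
  features, logits and finally log-probabilities.

  The analytic core is the inequality \<open>|Tr (C A)| \<le> \<parallel>A\<parallel>\<^sub>1\<close> for unitary \<open>C\<close>
  (\<open>norm_trace_unitary_mult_le_trace_norm\<close>), where the trace norm is a sum over the roots of the
  characteristic polynomial of \<open>A\<^sup>*A\<close>. It rests on the spectral theorem for the
  Hermitian matrix \<open>A\<^sup>*A\<close> (\<open>hermitian_unitarily_diagonalizable\<close>): in an orthonormal eigenbasis the
  singular values become the lengths of the columns of \<open>A P\<close>, and Cauchy--Schwarz applies to each
  diagonal entry of the trace.

  A feature is \<open>1 - \<gamma>\<close> times the expectation of \<open>V = U\<^sup>* \<sigma>\<^sub>z U\<close> in the encoded state, plus a constant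
  that depends only on \<open>\<gamma>\<close> and the observable (\<open>features_heisenberg\<close>). As \<open>V\<close> is unitary, two
  states at trace distance \<open>t\<close> have features that differ by at most \<open>2 (1 - \<gamma>) t\<close>
  (\<open>features_lipschitz\<close>). Adjacent parameters have \<open>t \<le> L\<^sub>e\<^sub>n\<^sub>c \<Delta>\<^sub>\<theta>\<close>, so their logits differ
  by at most \<open>\<eta> = 2 (1 - \<gamma>) L\<^sub>e\<^sub>n\<^sub>c \<Delta>\<^sub>\<theta> \<parallel>W\<^sub>c\<^sub>l\<parallel>\<close> (\<open>logits_lipschitz\<close>). A change of all logits by at most
  \<open>\<eta>\<close> changes each softmax probability by a factor of at most \<open>exp (2 \<beta> \<eta>)\<close>
  (\<open>softmax_prob_ratio\<close>), and \<open>2 \<beta> \<eta>\<close> is the stated bound.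
\<close>

(* Leaves the dot symbol to the scalar product of vectors with variable dimension. *)
unbundle no inner_syntax

section \<open>Adjoint and trace\<close>

lemma dim_mat_adjoint [simp]:
  "dim_row (mat_adjoint A) = dim_col A" "dim_col (mat_adjoint A) = dim_row A"
  by (simp_all add: mat_adjoint_def)

lemma index_mat_adjoint [simp]:
  "i < dim_col A \<Longrightarrow> j < dim_row A \<Longrightarrow> mat_adjoint A $$ (i, j) = conjugate (A $$ (j, i))"
  by (simp add: mat_adjoint_def mat_of_rows_def)

lemma mat_adjoint_carrier [simp, intro]:
  "A \<in> carrier_mat n m \<Longrightarrow> mat_adjoint A \<in> carrier_mat m n"
  by (intro carrier_matI) auto

lemma mat_adjoint_mat_adjoint [simp]: "mat_adjoint (mat_adjoint A) = A"
  by (rule eq_matI) auto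

lemma index_mult_mat_sum:
  "A \<in> carrier_mat n m \<Longrightarrow> B \<in> carrier_mat m k \<Longrightarrow> i < n \<Longrightarrow> j < k \<Longrightarrow>
   (A * B) $$ (i, j) = (\<Sum>l<m. A $$ (i, l) * B $$ (l, j))"
  by (simp add: scalar_prod_def atLeast0LessThan)

lemma mat_adjoint_mult:
  fixes A :: "complex mat"
  assumes A: "A \<in> carrier_mat n m" and B: "B \<in> carrier_mat m k"
  shows "mat_adjoint (A * B) = mat_adjoint B * mat_adjoint A"
proof (rule eq_matI)
  fix i j
  assume "i < dim_row (mat_adjoint B * mat_adjoint A)" "j < dim_col (mat_adjoint B * mat_adjoint A)"
  then have ij: "i < k" "j < n"
    using A B by auto
  have "mat_adjoint (A * B) $$ (i, j) = cnj ((A * B) $$ (j, i))"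
    using A B ij by simp
  also have "\<dots> = (\<Sum>l<m. cnj (A $$ (j, l)) * cnj (B $$ (l, i)))"
    by (simp only: index_mult_mat_sum[OF A B ij(2) ij(1)] cnj_sum complex_cnj_mult)
  also have "\<dots> = (\<Sum>l<m. mat_adjoint B $$ (i, l) * mat_adjoint A $$ (l, j))"
    using A B ij by (intro sum.cong) auto
  also have "\<dots> = (mat_adjoint B * mat_adjoint A) $$ (i, j)"
    using index_mult_mat_sum[OF mat_adjoint_carrier[OF B] mat_adjoint_carrier[OF A] ij] by simp
  finally show "mat_adjoint (A * B) $$ (i, j) = (mat_adjoint B * mat_adjoint A) $$ (i, j)" .
qed (use A B in auto)

lemma mat_trace_mult_comm:
  fixes A :: "'a::comm_semiring_0 mat"
  assumes A: "A \<in> carrier_mat n m" and B: "B \<in> carrier_mat m n"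
  shows "mat_trace (A * B) = mat_trace (B * A)"
proof -
  have "mat_trace (A * B) = (\<Sum>i<n. \<Sum>l<m. A $$ (i, l) * B $$ (l, i))"
    unfolding mat_trace_def using index_mult_mat_sum[OF A B] A by auto
  also have "\<dots> = (\<Sum>l<m. \<Sum>i<n. B $$ (l, i) * A $$ (i, l))"
    by (subst sum.swap) (simp add: mult.commute)
  also have "\<dots> = mat_trace (B * A)"
    unfolding mat_trace_def using index_mult_mat_sum[OF B A] B by auto
  finally show ?thesis .
qed

section \<open>Unitary matrices and the spectral theorem\<close>

lemma unitary_matI:
  assumes "U \<in> carrier_mat d d" "mat_adjoint U * U = 1\<^sub>m d"
  shows "unitary_mat d U"
  using assms mat_mult_left_right_inverse[OF mat_adjoint_carrier[OF assms(1)] assms(1)]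
  by (auto simp: unitary_mat_def)

lemma unitary_mat_adjoint: "unitary_mat d U \<Longrightarrow> unitary_mat d (mat_adjoint U)"
  by (auto simp: unitary_mat_def)

lemma unitary_mat_mult:
  assumes U: "unitary_mat d U" and V: "unitary_mat d V"
  shows "unitary_mat d (U * V)"
proof (rule unitary_matI)
  from U V have c: "U \<in> carrier_mat d d" "V \<in> carrier_mat d d"
    by (auto simp: unitary_mat_def)
  then show "U * V \<in> carrier_mat d d"
    by auto
  have "mat_adjoint (U * V) * (U * V) = (mat_adjoint V * mat_adjoint U) * (U * V)"
    using c by (simp add: mat_adjoint_mult)
  also have "\<dots> = mat_adjoint V * (mat_adjoint U * (U * V))"
    using c by (intro assoc_mult_mat[of _ d d _ d _ d]) auto
  also have "mat_adjoint U * (U * V) = (mat_adjoint U * U) * V"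
    using c by (intro assoc_mult_mat[symmetric, of _ d d _ d _ d]) auto
  finally show "mat_adjoint (U * V) * (U * V) = 1\<^sub>m d"
    using U V c by (simp add: unitary_mat_def)
qed

text \<open>
  Gram--Schmidt on a basis that starts with \<open>v\<close> gives orthogonal vectors headed by \<open>v\<close> itself;
  dividing each by its length makes the matrix of columns unitary and rescales the first
  column by the scalar \<open>c\<close>.
\<close>

lemma unitary_mat_with_first_column:
  fixes v :: "complex vec"
  assumes v: "v \<in> carrier_vec n" and v0: "v \<noteq> 0\<^sub>v n"
  obtains W c where "unitary_mat n W" "col W 0 = c \<cdot>\<^sub>v v"
proof -
  interpret cof_vec_space n "TYPE(complex)" .
  define b where "b = basis_completion v"
  define ws where "ws = gram_schmidt n b"
  note bc = basis_completion[OF v v0, folded b_def]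
  have n: "0 < n"
    using v v0 by (metis carrier_vecD eq_vecI gr0I index_zero_vec(2) not_less_zero)
  then obtain vs where b: "b = v # vs"
    using bc(6,7) by (cases b) auto
  have ws: "set ws \<subseteq> carrier_vec n" "corthogonal ws" "length ws = n"
    using gram_schmidt_result[OF bc(2) bc(4) bc(5) ws_def] bc(6) by auto
  have ws0: "ws ! 0 = v"
    using gram_schmidt_hd[OF v, of vs, folded b ws_def] ws(3) n by (cases ws) auto
  have wsc: "ws ! i \<in> carrier_vec n" if "i < n" for i
    using ws that by auto
  define r where "r i = complex_of_real (1 / sqrt (Re (ws ! i \<bullet>c ws ! i)))" for i
  have norm1: "cnj (r i) * r i * (ws ! i \<bullet>c ws ! i) = 1" if i: "i < n" for i
  proof -
    let ?z = "ws ! i \<bullet>c ws ! i"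
    have "?z \<noteq> 0"
      using corthogonalD[OF ws(2), of i i] i ws(3) by auto
    moreover have "0 \<le> ?z"
      by (rule conjugate_square_ge_0_vec)
    ultimately have z: "?z = complex_of_real (Re ?z)" and pos: "0 < Re ?z"
      by (auto simp: less_eq_complex_def complex_eq_iff)
    have "cnj (r i) * r i = complex_of_real (1 / Re ?z)"
      using pos by (simp add: r_def flip: of_real_mult)
    then show ?thesis
      using pos by (subst z) (simp flip: of_real_mult)
  qed
  define W where "W = mat_of_cols n (map (\<lambda>i. r i \<cdot>\<^sub>v ws ! i) [0..<n])"
  have W: "W \<in> carrier_mat n n"
    by (auto simp: W_def)
  have colW: "col W i = r i \<cdot>\<^sub>v ws ! i" if "i < n" for i
    unfolding W_def using that wsc by (subst col_mat_of_cols) auto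
  have "mat_adjoint W * W = 1\<^sub>m n"
  proof (rule eq_matI)
    fix i j assume "i < dim_row (1\<^sub>m n)" "j < dim_col (1\<^sub>m n)"
    then have ij: "i < n" "j < n" by auto
    have row: "row (mat_adjoint W) i = conjugate (col W i)"
      using W ij by (intro eq_vecI) auto
    have "(mat_adjoint W * W) $$ (i, j) = row (mat_adjoint W) i \<bullet> col W j"
      using W ij by simp
    also have "\<dots> = col W j \<bullet>c col W i"
      unfolding row using W ij by (intro comm_scalar_prod[of _ n]) auto
    also have "\<dots> = cnj (r i) * r j * (ws ! j \<bullet>c ws ! i)"
      using carrier_vecD[OF wsc[OF ij(1)]] carrier_vecD[OF wsc[OF ij(2)]] ij
      by (simp add: colW conjugate_smult_vec mult_ac)
    also have "\<dots> = 1\<^sub>m n $$ (i, j)"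
      using norm1[OF ij(1)] corthogonalD[OF ws(2), of j i] ij ws(3) by (cases "i = j") auto
    finally show "(mat_adjoint W * W) $$ (i, j) = 1\<^sub>m n $$ (i, j)" .
  qed (use W in auto)
  then have "unitary_mat n W"
    using W by (rule unitary_matI[rotated])
  then show ?thesis
    using that[of W "r 0"] colW[OF n] ws0 by simp
qed

lemma mult_block_diag_mat:
  assumes "A \<in> carrier_mat m m" "A' \<in> carrier_mat m m"
    and "B \<in> carrier_mat n n" "B' \<in> carrier_mat n n"
  shows "four_block_mat A (0\<^sub>m m n) (0\<^sub>m n m) B * four_block_mat A' (0\<^sub>m m n) (0\<^sub>m n m) B' =
    four_block_mat (A * A') (0\<^sub>m m n) (0\<^sub>m n m) (B * B' :: 'a::semiring_1 mat)"
proof -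
  have "A * A' \<in> carrier_mat m m" "B * B' \<in> carrier_mat n n"
    using assms by (auto intro: mult_carrier_mat)
  then show ?thesis
    using assms by (subst mult_four_block_mat[of _ m m _ n _ n _ _ m _ n]) auto
qed

text \<open>
  Spectral theorem, by deflation. In an orthonormal basis whose first vector is an eigenvector,
  the first column of the matrix is zero below the diagonal; being Hermitian, the matrix then also
  has a zero first row beyond the diagonal. It thus splits into a number and a smaller Hermitian
  block, to which the induction hypothesis applies.
\<close>

lemma hermitian_unitarily_diagonalizable:
  fixes M :: "complex mat"
  assumes "M \<in> carrier_mat n n" "mat_adjoint M = M"
  shows "\<exists>P. unitary_mat n P \<and> diagonal_mat (mat_adjoint P * M * P)"
  using assms
proof (induction n arbitrary: M)
  case 0
  then show ?case
    by (intro exI[of _ "1\<^sub>m 0"]) (auto simp: unitary_mat_def diagonal_mat_def)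
next
  case (Suc n)
  note M = Suc.prems(1) and herm = Suc.prems(2)
  obtain e where "eigenvalue M e"
    using spectrum_non_empty[OF M] by (auto simp: spectrum_def)
  then obtain v where v: "v \<in> carrier_vec (Suc n)" "v \<noteq> 0\<^sub>v (Suc n)" "M *\<^sub>v v = e \<cdot>\<^sub>v v"
    using M by (auto simp: eigenvalue_def eigenvector_def)
  obtain W c where W: "unitary_mat (Suc n) W" and colW: "col W 0 = c \<cdot>\<^sub>v v"
    using unitary_mat_with_first_column[OF v(1,2)] by blast
  from W have Wc: "W \<in> carrier_mat (Suc n) (Suc n)" and W1: "mat_adjoint W * W = 1\<^sub>m (Suc n)"
    by (auto simp: unitary_mat_def)
  define N where "N = mat_adjoint W * M * W"
  have Nc: "N \<in> carrier_mat (Suc n) (Suc n)"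
    unfolding N_def using Wc M by (auto intro!: mult_carrier_mat)
  have hermN: "mat_adjoint N = N"
  proof -
    have "mat_adjoint N = mat_adjoint W * mat_adjoint (mat_adjoint W * M)"
      unfolding N_def using Wc M by (intro mat_adjoint_mult) (auto intro!: mult_carrier_mat)
    also have "mat_adjoint (mat_adjoint W * M) = M * W"
      using mat_adjoint_mult[OF mat_adjoint_carrier[OF Wc] M] herm by simp
    also have "mat_adjoint W * (M * W) = N"
      unfolding N_def using Wc M by (intro assoc_mult_mat[symmetric]) auto
    finally show ?thesis .
  qed
  have "col N 0 = e \<cdot>\<^sub>v unit_vec (Suc n) 0"
  proof -
    have "N = mat_adjoint W * (M * W)"
      unfolding N_def using Wc M by (intro assoc_mult_mat) auto
    then have "col N 0 = mat_adjoint W *\<^sub>v col (M * W) 0"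
      using col_mult2[OF mat_adjoint_carrier[OF Wc] mult_carrier_mat[OF M Wc]] by simp
    also have "col (M * W) 0 = M *\<^sub>v col W 0"
      using col_mult2[OF M Wc] by simp
    also have "M *\<^sub>v col W 0 = e \<cdot>\<^sub>v col W 0"
      unfolding colW using M v by (simp add: mult_mat_vec smult_smult_assoc mult.commute)
    also have "mat_adjoint W *\<^sub>v (e \<cdot>\<^sub>v col W 0) = e \<cdot>\<^sub>v col (mat_adjoint W * W) 0"
      using mult_mat_vec[OF mat_adjoint_carrier[OF Wc], of "col W 0" e]
        col_mult2[OF mat_adjoint_carrier[OF Wc] Wc, of 0] Wc by (simp add: carrier_vecI)
    finally show ?thesis
      unfolding W1 by simp
  qed
  then have "col N 0 $ i = (if i = 0 then e else 0)" if "i < Suc n" for i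
    using that by simp
  then have col0: "N $$ (i, 0) = (if i = 0 then e else 0)" if "i < Suc n" for i
    using that Nc by simp
  have row0: "N $$ (0, i) = 0" if "i < Suc n" "i \<noteq> 0" for i
    using index_mat_adjoint[of 0 N i] that Nc col0[of i] by (simp add: hermN)
  define N' where "N' = mat n n (\<lambda>(i, j). N $$ (Suc i, Suc j))"
  have N'c: "N' \<in> carrier_mat n n"
    by (simp add: N'_def)
  have Nblock: "N = four_block_mat (mat 1 1 (\<lambda>_. e)) (0\<^sub>m 1 n) (0\<^sub>m n 1) N'"
    using Nc col0 row0 by (intro eq_matI) (auto simp: N'_def)
  have "mat_adjoint N' = N'"
  proof (rule eq_matI)
    fix i j assume "i < dim_row N'" "j < dim_col N'"
    then show "mat_adjoint N' $$ (i, j) = N' $$ (i, j)"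
      using index_mat_adjoint[of "Suc i" N "Suc j"] Nc by (simp add: hermN N'_def)
  qed (auto simp: N'_def)
  then obtain P' where P': "unitary_mat n P'" and diag: "diagonal_mat (mat_adjoint P' * N' * P')"
    using Suc.IH[OF N'c] by blast
  from P' have P'c: "P' \<in> carrier_mat n n" and P'1: "mat_adjoint P' * P' = 1\<^sub>m n"
    by (auto simp: unitary_mat_def)
  define Q where "Q = four_block_mat (1\<^sub>m 1) (0\<^sub>m 1 n) (0\<^sub>m n 1) P'"
  have Qc: "Q \<in> carrier_mat (Suc n) (Suc n)"
    unfolding Q_def using four_block_carrier_mat[OF one_carrier_mat[of 1] P'c] by simp
  have adjQ: "mat_adjoint Q = four_block_mat (1\<^sub>m 1) (0\<^sub>m 1 n) (0\<^sub>m n 1) (mat_adjoint P')"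
    using P'c by (intro eq_matI) (auto simp: Q_def)
  have "mat_adjoint Q * Q = 1\<^sub>m (Suc n)"
    unfolding adjQ unfolding Q_def using P'c P'1
    by (simp add: mult_block_diag_mat[of _ "Suc 0" _ _ n])
  then have Q: "unitary_mat (Suc n) Q"
    by (rule unitary_matI[OF Qc])
  have "mat_adjoint (W * Q) * M * (W * Q) = mat_adjoint Q * N * Q"
  proof -
    have "mat_adjoint (W * Q) * M * (W * Q) = (mat_adjoint Q * mat_adjoint W) * M * (W * Q)"
      using mat_adjoint_mult[OF Wc Qc] by simp
    also have "\<dots> = mat_adjoint Q * N * Q"
      unfolding N_def using Wc Qc M
      by (simp add: assoc_mult_mat[of _ "Suc n" "Suc n" _ "Suc n" _ "Suc n"]
          mult_carrier_mat[of _ "Suc n" "Suc n" _ "Suc n"])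
    finally show ?thesis .
  qed
  also have "\<dots> = four_block_mat (mat 1 1 (\<lambda>_. e)) (0\<^sub>m 1 n) (0\<^sub>m n 1) (mat_adjoint P' * N' * P')"
    unfolding adjQ unfolding Q_def Nblock using P'c N'c
    by (simp add: mult_block_diag_mat[of _ "Suc 0" _ _ n] mult_carrier_mat[of _ n n _ n])
  finally have "diagonal_mat (mat_adjoint (W * Q) * M * (W * Q))"
    using diag P'c N'c by (auto simp: diagonal_mat_def)
  then show ?case
    using unitary_mat_mult[OF W Q] by blast
qed

section \<open>Trace norm and unitary observables\<close>

lemma proots_prod_list_linear:
  "proots (\<Prod>a\<leftarrow>xs. [:- a, 1:]) = mset (xs :: 'a::field list)"
proof (induction xs)
  case (Cons a xs)
  have "(\<Prod>a\<leftarrow>xs. [:- a, 1:]) \<noteq> 0"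
    by auto
  with Cons show ?case
    by (simp add: proots_mult del: mult_pCons_left)
qed simp

text \<open>
  Similar matrices have the same characteristic polynomial, and that of a diagonal matrix
  displays the diagonal as its roots with multiplicity. So the singular values can be read off
  from any diagonalization of \<open>A\<^sup>*A\<close>, and a sum over roots of a polynomial becomes a sum over
  matrix indices.
\<close>

lemma trace_norm_eq_sum_sqrt_diag:
  assumes A: "A \<in> carrier_mat n n" and P: "unitary_mat n P"
    and diag: "diagonal_mat (mat_adjoint P * (mat_adjoint A * A) * P)" (is "diagonal_mat ?D")
  shows "trace_norm A = (\<Sum>i<n. sqrt (Re (?D $$ (i, i))))"
proof -
  have Pc: "P \<in> carrier_mat n n"
    using P by (simp add: unitary_mat_def)
  have Mc: "mat_adjoint A * A \<in> carrier_mat n n"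
    using A by (auto intro: mult_carrier_mat)
  have Dc: "?D \<in> carrier_mat n n"
    using Pc Mc by (auto intro!: mult_carrier_mat)
  have "similar_mat_wit ?D (mat_adjoint A * A) (mat_adjoint P) P"
    using P Pc Mc Dc by (intro similar_mat_witI[of _ _ n]) (auto simp: unitary_mat_def)
  then have "char_poly (mat_adjoint A * A) = char_poly ?D"
    by (metis char_poly_similar similar_mat_def)
  also have "\<dots> = (\<Prod>a\<leftarrow>diag_mat ?D. [:- a, 1:])"
    using diag by (intro char_poly_upper_triangular[OF Dc]) (auto simp: diagonal_mat_def upper_triangular_def)
  finally have "proots (char_poly (mat_adjoint A * A)) = mset (diag_mat ?D)"
    by (simp add: proots_prod_list_linear)
  then have "trace_norm A = sum_list (map (\<lambda>i. sqrt (Re (?D $$ (i, i)))) [0..<n])"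
    using Pc unfolding trace_norm_def singular_values_def diag_mat_def
    by (simp add: mset_map[symmetric] sum_mset_sum_list comp_def del: mset_map)
  then show ?thesis
    by (simp add: interv_sum_list_conv_sum_set_nat atLeast0LessThan)
qed

lemma gram_diag_eq_column_norm:
  fixes Y :: "complex mat"
  assumes "Y \<in> carrier_mat m n" "i < n"
  shows "(mat_adjoint Y * Y) $$ (i, i) = complex_of_real (\<Sum>l<m. (cmod (Y $$ (l, i)))\<^sup>2)"
  using assms
  by (simp add: index_mult_mat_sum[OF mat_adjoint_carrier[OF assms(1)] assms(1) assms(2,2)]
      complex_norm_square[symmetric] mult.commute del: index_mult_mat)

text \<open>
  The duality between trace norm and operator norm, for unitary \<open>C\<close>. Let the unitary \<open>P\<close>
  diagonalize \<open>A\<^sup>*A\<close>. Then \<open>Tr (C A) = Tr (X Y)\<close> with \<open>X = P\<^sup>*C\<close> unitary and \<open>Y = A P\<close>. The columns of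
  \<open>Y\<close> have the singular values of \<open>A\<close> as their lengths, because \<open>Y\<^sup>*Y\<close> is the diagonal form of
  \<open>A\<^sup>*A\<close>, and the rows of \<open>X\<close> have length one. Cauchy--Schwarz bounds the \<open>i\<close>-th diagonal entry
  of \<open>X Y\<close> by the \<open>i\<close>-th singular value.
\<close>

lemma norm_trace_unitary_mult_le_trace_norm:
  assumes C: "unitary_mat n C" and A: "A \<in> carrier_mat n n"
  shows "cmod (mat_trace (C * A)) \<le> trace_norm A"
proof -
  have Cc: "C \<in> carrier_mat n n"
    using C by (simp add: unitary_mat_def)
  have "mat_adjoint (mat_adjoint A * A) = mat_adjoint A * A"
    using mat_adjoint_mult[OF mat_adjoint_carrier[OF A] A] by simp
  then obtain P where P: "unitary_mat n P"
    and diag: "diagonal_mat (mat_adjoint P * (mat_adjoint A * A) * P)"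
    using hermitian_unitarily_diagonalizable[of "mat_adjoint A * A" n] A
    by (auto intro: mult_carrier_mat)
  have Pc: "P \<in> carrier_mat n n" and PP: "P * mat_adjoint P = 1\<^sub>m n"
    using P by (auto simp: unitary_mat_def)
  define X where "X = mat_adjoint P * C"
  define Y where "Y = A * P"
  have Xc: "X \<in> carrier_mat n n" and Yc: "Y \<in> carrier_mat n n"
    using Pc Cc A by (auto simp: X_def Y_def intro!: mult_carrier_mat)
  note assoc = assoc_mult_mat[of _ n n _ n _ n] mult_carrier_mat[of _ n n _ n]
  have D: "mat_adjoint P * (mat_adjoint A * A) * P = mat_adjoint Y * Y"
    using A Pc unfolding Y_def by (simp add: mat_adjoint_mult[OF A Pc] assoc)
  have X: "(\<Sum>l<n. (cmod (X $$ (i, l)))\<^sup>2) = 1" if i: "i < n" for i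
  proof -
    have "X * mat_adjoint X = 1\<^sub>m n"
      using unitary_mat_mult[OF unitary_mat_adjoint[OF P] C] by (simp add: X_def unitary_mat_def)
    then have "complex_of_real (\<Sum>l<n. (cmod (mat_adjoint X $$ (l, i)))\<^sup>2) = 1"
      using gram_diag_eq_column_norm[OF mat_adjoint_carrier[OF Xc] i] i by simp
    then have "(\<Sum>l<n. (cmod (mat_adjoint X $$ (l, i)))\<^sup>2) = 1"
      using of_real_eq_1_iff by blast
    then show ?thesis
      using Xc i by simp
  qed
  have "mat_trace (X * Y) = mat_trace (mat_adjoint P * ((C * A) * P))"
    using Pc Cc A by (simp add: X_def Y_def assoc)
  also have "\<dots> = mat_trace ((C * A) * P * mat_adjoint P)"
    using Pc Cc A by (intro mat_trace_mult_comm[of _ n n]) (auto intro!: mult_carrier_mat)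
  also have "\<dots> = mat_trace (C * A)"
    using Pc Cc A PP by (simp add: assoc)
  finally have "mat_trace (C * A) = (\<Sum>i<n. \<Sum>l<n. X $$ (i, l) * Y $$ (l, i))"
    using index_mult_mat_sum[OF Xc Yc] Xc Yc by (simp add: mat_trace_def)
  then have "cmod (mat_trace (C * A)) \<le> (\<Sum>i<n. cmod (\<Sum>l<n. X $$ (i, l) * Y $$ (l, i)))"
    by (simp add: norm_sum)
  also have "\<dots> \<le> (\<Sum>i<n. sqrt (Re ((mat_adjoint Y * Y) $$ (i, i))))"
  proof (rule sum_mono)
    fix i assume "i \<in> {..<n}"
    then have i: "i < n" by simp
    have "cmod (\<Sum>l<n. X $$ (i, l) * Y $$ (l, i)) \<le> (\<Sum>l<n. \<bar>cmod (X $$ (i, l))\<bar> * \<bar>cmod (Y $$ (l, i))\<bar>)"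
      by (rule order.trans[OF norm_sum]) (simp add: norm_mult)
    also have "\<dots> \<le> L2_set (\<lambda>l. cmod (X $$ (i, l))) {..<n} * L2_set (\<lambda>l. cmod (Y $$ (l, i))) {..<n}"
      by (rule L2_set_mult_ineq)
    also have "\<dots> = sqrt (Re ((mat_adjoint Y * Y) $$ (i, i)))"
      using X[OF i] gram_diag_eq_column_norm[OF Yc i] by (simp add: L2_set_def)
    finally show "cmod (\<Sum>l<n. X $$ (i, l) * Y $$ (l, i)) \<le> sqrt (Re ((mat_adjoint Y * Y) $$ (i, i)))" .
  qed
  also have "\<dots> = trace_norm A"
    using trace_norm_eq_sum_sqrt_diag[OF A P diag] D by simp
  finally show ?thesis .
qed

section \<open>Sensitivity of the features\<close>

text \<open>The diagonal unitary matrices, in a form that is checked entry by entry.\<close>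

definition phase_mat :: "nat \<Rightarrow> complex mat \<Rightarrow> bool" where
  "phase_mat d A \<longleftrightarrow> A \<in> carrier_mat d d \<and> diagonal_mat A \<and> (\<forall>i<d. cmod (A $$ (i, i)) = 1)"

lemma phase_mat_unitary:
  assumes "phase_mat d A" shows "unitary_mat d A"
proof (rule unitary_matI)
  show A: "A \<in> carrier_mat d d"
    using assms by (simp add: phase_mat_def)
  show "mat_adjoint A * A = 1\<^sub>m d"
  proof (rule eq_matI)
    fix i j assume "i < dim_row (1\<^sub>m d)" "j < dim_col (1\<^sub>m d)"
    then have ij: "i < d" "j < d" by auto
    have "(mat_adjoint A * A) $$ (i, j) = (\<Sum>l<d. cnj (A $$ (l, i)) * A $$ (l, j))"
      using A ij index_mult_mat_sum[OF mat_adjoint_carrier[OF A] A ij] by simp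
    also have "\<dots> = (\<Sum>l<d. if l = i then cnj (A $$ (i, i)) * A $$ (i, j) else 0)"
      using assms ij by (intro sum.cong) (auto simp: phase_mat_def diagonal_mat_def)
    also have "\<dots> = 1\<^sub>m d $$ (i, j)"
      using assms ij
      by (auto simp: phase_mat_def diagonal_mat_def mult.commute[of "cnj _"] complex_norm_square[symmetric])
    finally show "(mat_adjoint A * A) $$ (i, j) = 1\<^sub>m d $$ (i, j)" .
  qed (use A in auto)
qed

lemma phase_mat_one: "phase_mat d (1\<^sub>m d)"
  by (auto simp: phase_mat_def diagonal_mat_def)

lemma phase_mat_pauli_z: "phase_mat 2 pauli_z"
  by (auto simp: phase_mat_def diagonal_mat_def pauli_z_def mat_of_rows_list_def numeral_2_eq_2 less_Suc_eq)

text \<open>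
  Division with remainder by \<open>b\<close> splits an index of the product into its two parts, and distinct
  indices differ in at least one of them.
\<close>

lemma phase_mat_kron:
  assumes A: "phase_mat a A" and B: "phase_mat b B"
  shows "phase_mat (a * b) (kron A B)"
proof -
  have c: "A \<in> carrier_mat a a" "B \<in> carrier_mat b b"
    using A B by (auto simp: phase_mat_def)
  have lt: "i div b < a" "i mod b < b" if "i < a * b" for i
    using that by (auto simp: less_mult_imp_div_less) (metis mod_less_divisor mult_0_right not_gr_zero not_less_zero)
  have neq: "i div b \<noteq> j div b \<or> i mod b \<noteq> j mod b" if "i \<noteq> j" for i j
    using that by (metis div_mult_mod_eq)
  have entry: "kron A B $$ (i, j) = A $$ (i div b, j div b) * B $$ (i mod b, j mod b)"
    if "i < a * b" "j < a * b" for i j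
    using c that by (simp add: kron_def)
  show ?thesis
    unfolding phase_mat_def diagonal_mat_def
  proof (intro conjI allI impI)
    show k: "kron A B \<in> carrier_mat (a * b) (a * b)"
      using c by (auto simp: kron_def)
    show "kron A B $$ (i, j) = 0"
      if "i < dim_row (kron A B)" "j < dim_col (kron A B)" "i \<noteq> j" for i j
    proof -
      have ij: "i < a * b" "j < a * b" using that k by auto
      show ?thesis
        using A B c entry[OF ij] neq[OF that(3)] lt[OF ij(1)] lt[OF ij(2)]
        by (auto simp: phase_mat_def diagonal_mat_def)
    qed
    show "cmod (kron A B $$ (i, i)) = 1" if "i < a * b" for i
      using A B entry[OF that that] lt[OF that] by (simp add: phase_mat_def norm_mult)
  qed
qed

text \<open>
  A Pauli-Z on one qubit is a Kronecker product of diagonal matrices with unimodular entries, and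
  such matrices are closed under Kronecker products.
\<close>

lemma unitary_pauli_z_on:
  assumes "j < n" shows "unitary_mat (2 ^ n) (pauli_z_on n j)"
proof -
  have "(2::nat) ^ n = 2 ^ j * 2 * 2 ^ (n - Suc j)"
    using assms by (metis Suc_leI le_add_diff_inverse power_Suc2 power_add)
  then show ?thesis
    unfolding pauli_z_on_def
    by (simp only:) (intro phase_mat_unitary phase_mat_kron phase_mat_one phase_mat_pauli_z)
qed

lemma mat_trace_add:
  "A \<in> carrier_mat n n \<Longrightarrow> B \<in> carrier_mat n n \<Longrightarrow> mat_trace (A + B) = mat_trace A + mat_trace B"
  by (simp add: mat_trace_def sum.distrib)

lemma mat_trace_minus:
  fixes A :: "'a::ab_group_add mat"
  shows "A \<in> carrier_mat n n \<Longrightarrow> B \<in> carrier_mat n n \<Longrightarrow> mat_trace (A - B) = mat_trace A - mat_trace B"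
  by (simp add: mat_trace_def sum_subtractf)

lemma mat_trace_smult:
  fixes A :: "'a::comm_semiring_0 mat"
  shows "A \<in> carrier_mat n n \<Longrightarrow> mat_trace (c \<cdot>\<^sub>m A) = c * mat_trace A"
  by (simp add: mat_trace_def sum_distrib_left)

text \<open>
  The Heisenberg picture: by cyclicity of the trace the circuit can be moved from the state to
  the observable. Depolarizing scales the expectation by \<open>1 - \<gamma>\<close> and adds an offset that is the
  same for every input state.
\<close>

lemma features_heisenberg:
  assumes U: "unitary_mat (2 ^ n) U" and \<rho>: "\<rho> \<in> carrier_mat (2 ^ n) (2 ^ n)" and j: "j < n"
  shows "features n \<gamma> U \<rho> $ j =
    (1 - \<gamma>) * Re (mat_trace (mat_adjoint U * pauli_z_on n j * U * \<rho>))
    + \<gamma> / 2 ^ n * Re (mat_trace (pauli_z_on n j))"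
proof -
  let ?d = "2 ^ n :: nat" and ?Z = "pauli_z_on n j"
  have c: "U \<in> carrier_mat ?d ?d" "?Z \<in> carrier_mat ?d ?d"
    using U unitary_pauli_z_on[OF j] by (auto simp: unitary_mat_def)
  note assoc = assoc_mult_mat[of _ ?d ?d _ ?d _ ?d] mult_carrier_mat[of _ ?d ?d _ ?d]
  define R where "R = U * \<rho> * mat_adjoint U"
  have R: "R \<in> carrier_mat ?d ?d"
    unfolding R_def using c \<rho> by (auto intro!: mult_carrier_mat)
  have "mat_trace (?Z * depolarizing ?d \<gamma> R) =
      complex_of_real (1 - \<gamma>) * mat_trace (?Z * R) + (complex_of_real \<gamma> / of_nat ?d) * mat_trace ?Z"
    unfolding depolarizing_def using c R
    by (simp add: mult_add_distrib_mat[of _ ?d ?d _ ?d] mult_smult_distrib[of _ ?d ?d _ ?d]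
        mat_trace_add[of _ ?d] mat_trace_smult[of _ ?d] mult_carrier_mat[of _ ?d ?d _ ?d])
  moreover have "mat_trace (?Z * R) = mat_trace (mat_adjoint U * ?Z * U * \<rho>)"
  proof -
    have "mat_trace (?Z * R) = mat_trace ((?Z * U * \<rho>) * mat_adjoint U)"
      unfolding R_def using c \<rho> by (simp add: assoc)
    also have "\<dots> = mat_trace (mat_adjoint U * (?Z * U * \<rho>))"
      using c \<rho> by (intro mat_trace_mult_comm[of _ ?d ?d]) (auto intro!: mult_carrier_mat)
    also have "\<dots> = mat_trace (mat_adjoint U * ?Z * U * \<rho>)"
      using c \<rho> by (simp add: assoc)
    finally show ?thesis .
  qed
  ultimately have "mat_trace (?Z * depolarizing ?d \<gamma> R) =
      complex_of_real (1 - \<gamma>) * mat_trace (mat_adjoint U * ?Z * U * \<rho>)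
      + complex_of_real (\<gamma> / 2 ^ n) * mat_trace ?Z"
    by simp
  then show ?thesis
    using j by (simp add: features_def R_def del: of_real_diff of_real_divide)
qed

text \<open>
  The offset of the depolarizing channel cancels in the difference. The factor 2
  compensates for the \<open>1/2\<close> in the definition of trace distance.
\<close>

lemma features_lipschitz:
  assumes U: "unitary_mat (2 ^ n) U" and \<gamma>: "\<gamma> \<le> 1" and j: "j < n"
    and \<rho>: "\<rho> \<in> carrier_mat (2 ^ n) (2 ^ n)" and \<rho>': "\<rho>' \<in> carrier_mat (2 ^ n) (2 ^ n)"
  shows "\<bar>features n \<gamma> U \<rho> $ j - features n \<gamma> U \<rho>' $ j\<bar> \<le> 2 * (1 - \<gamma>) * trace_distance \<rho> \<rho>'"
proof -
  let ?d = "2 ^ n :: nat"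
  define V where "V = mat_adjoint U * pauli_z_on n j * U"
  have V: "unitary_mat ?d V"
    unfolding V_def by (intro unitary_mat_mult unitary_mat_adjoint U unitary_pauli_z_on j)
  then have Vc: "V \<in> carrier_mat ?d ?d"
    by (simp add: unitary_mat_def)
  have "mat_trace (V * \<rho>) - mat_trace (V * \<rho>') = mat_trace (V * (\<rho> - \<rho>'))"
    using Vc \<rho> \<rho>' by (simp add: mult_minus_distrib_mat[of _ ?d ?d _ ?d] mat_trace_minus[of _ ?d] mult_carrier_mat[of _ ?d ?d _ ?d])
  then have "features n \<gamma> U \<rho> $ j - features n \<gamma> U \<rho>' $ j = (1 - \<gamma>) * Re (mat_trace (V * (\<rho> - \<rho>')))"
    unfolding features_heisenberg[OF U \<rho> j] features_heisenberg[OF U \<rho>' j] V_def[symmetric]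
    by (simp add: algebra_simps flip: minus_complex.simps)
  then have "\<bar>features n \<gamma> U \<rho> $ j - features n \<gamma> U \<rho>' $ j\<bar> \<le> (1 - \<gamma>) * cmod (mat_trace (V * (\<rho> - \<rho>')))"
    using \<gamma> by (simp add: abs_mult mult_left_mono abs_Re_le_cmod)
  also have "\<dots> \<le> (1 - \<gamma>) * trace_norm (\<rho> - \<rho>')"
    using \<gamma> \<rho> \<rho>' by (intro mult_left_mono norm_trace_unitary_mult_le_trace_norm[OF V]) auto
  also have "\<dots> = 2 * (1 - \<gamma>) * trace_distance \<rho> \<rho>'"
    by (simp add: trace_distance_def)
  finally show ?thesis .
qed

section \<open>Sensitivity of the logits and of the softmax\<close>

lemma sum_abs_row_le_norm_inf_1:
  "k < dim_row W \<Longrightarrow> (\<Sum>j<dim_col W. \<bar>W $$ (k, j)\<bar>) \<le> norm_inf_1 W"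
  unfolding norm_inf_1_def by (intro Max_ge) auto

lemma norm_inf_1_nonneg: "0 < dim_row W \<Longrightarrow> 0 \<le> norm_inf_1 W"
  by (rule order.trans[OF _ sum_abs_row_le_norm_inf_1[of 0 W]]) (simp_all add: sum_nonneg)

text \<open>
  Hoelder's inequality for each row: \<open>\<ell>\<^sub>1\<close> norm of the weights against the maximum of the
  feature differences.
\<close>

lemma logits_lipschitz:
  assumes W: "W \<in> carrier_mat K n" and b: "b \<in> carrier_vec K"
    and h: "h \<in> carrier_vec n" "h' \<in> carrier_vec n"
    and \<delta>: "0 \<le> \<delta>" "\<And>j. j < n \<Longrightarrow> \<bar>h $ j - h' $ j\<bar> \<le> \<delta>" and k: "k < K"
  shows "\<bar>logits W b h $ k - logits W b h' $ k\<bar> \<le> norm_inf_1 W * \<delta>"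
proof -
  have "logits W b h $ k - logits W b h' $ k = (\<Sum>j<n. W $$ (k, j) * (h $ j - h' $ j))"
    using W b h k
    by (simp add: logits_def scalar_prod_def atLeast0LessThan right_diff_distrib sum_subtractf)
  also have "\<bar>\<dots>\<bar> \<le> (\<Sum>j<n. \<bar>W $$ (k, j)\<bar> * \<delta>)"
    by (rule order.trans[OF sum_abs]) (auto simp: abs_mult intro!: sum_mono mult_left_mono \<delta>)
  also have "\<dots> = (\<Sum>j<n. \<bar>W $$ (k, j)\<bar>) * \<delta>"
    by (simp add: sum_distrib_right)
  also have "\<dots> \<le> norm_inf_1 W * \<delta>"
    using sum_abs_row_le_norm_inf_1[of k W] W k \<delta>(1) by (intro mult_right_mono) auto
  finally show ?thesis .
qed

lemma softmax_prob_nonneg: "0 \<le> softmax_prob \<beta> s k"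
  by (auto simp: softmax_prob_def intro!: divide_nonneg_nonneg sum_nonneg)

lemma sum_softmax_prob:
  assumes "1 \<le> dim_vec s" shows "(\<Sum>k\<in>{1..dim_vec s}. softmax_prob \<beta> s k) = 1"
proof -
  have "(\<Sum>j\<in>{1..dim_vec s}. exp (\<beta> * s $ (j - 1))) > 0"
    using assms by (intro sum_pos) auto
  then show ?thesis
    by (simp add: softmax_prob_def flip: sum_divide_distrib)
qed

text \<open>
  The numerator and the normalizing sum each change by a factor of at most
  \<open>exp (\<beta> \<eta>)\<close>, which is where the 2 in the exponent comes from.
\<close>

lemma softmax_prob_ratio:
  assumes dim: "dim_vec s = K" "dim_vec s' = K" and "0 \<le> \<beta>"
    and \<eta>: "\<And>i. i < K \<Longrightarrow> \<bar>s $ i - s' $ i\<bar> \<le> \<eta>" and k: "k \<in> {1..K}"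
  shows "softmax_prob \<beta> s k \<le> exp (2 * \<beta> * \<eta>) * softmax_prob \<beta> s' k"
proof -
  let ?Z = "\<lambda>s. \<Sum>j\<in>{1..K}. exp (\<beta> * s $ (j - 1))"
  have Z: "?Z s > 0" "?Z s' > 0"
    using k by (auto intro!: sum_pos)
  have le: "exp (\<beta> * s $ (j - 1)) \<le> exp (\<beta> * \<eta>) * exp (\<beta> * s' $ (j - 1))"
       "exp (\<beta> * s' $ (j - 1)) \<le> exp (\<beta> * \<eta>) * exp (\<beta> * s $ (j - 1))" if "j \<in> {1..K}" for j
  proof -
    have "\<bar>s $ (j - 1) - s' $ (j - 1)\<bar> \<le> \<eta>"
      using that by (intro \<eta>) auto
    then have "s $ (j - 1) \<le> \<eta> + s' $ (j - 1)" "s' $ (j - 1) \<le> \<eta> + s $ (j - 1)"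
      by linarith+
    then have "\<beta> * s $ (j - 1) \<le> \<beta> * (\<eta> + s' $ (j - 1))" "\<beta> * s' $ (j - 1) \<le> \<beta> * (\<eta> + s $ (j - 1))"
      using \<open>0 \<le> \<beta>\<close> by (simp_all add: mult_left_mono)
    then show "exp (\<beta> * s $ (j - 1)) \<le> exp (\<beta> * \<eta>) * exp (\<beta> * s' $ (j - 1))"
       "exp (\<beta> * s' $ (j - 1)) \<le> exp (\<beta> * \<eta>) * exp (\<beta> * s $ (j - 1))"
      by (simp_all add: distrib_left flip: exp_add)
  qed
  have Zle: "?Z s' \<le> exp (\<beta> * \<eta>) * ?Z s"
    unfolding sum_distrib_left by (intro sum_mono le)
  have "softmax_prob \<beta> s k = exp (\<beta> * s $ (k - 1)) / ?Z s"
    by (simp add: softmax_prob_def dim)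
  also have "\<dots> \<le> (exp (\<beta> * \<eta>) * exp (\<beta> * s' $ (k - 1))) / (?Z s' / exp (\<beta> * \<eta>))"
    using Z Zle le(1)[OF k] by (intro frac_le) (auto simp: field_simps)
  also have "\<dots> = (exp (\<beta> * \<eta>) * exp (\<beta> * \<eta>)) * (exp (\<beta> * s' $ (k - 1)) / ?Z s')"
    by simp
  also have "\<dots> = exp (2 * \<beta> * \<eta>) * softmax_prob \<beta> s' k"
    by (simp add: softmax_prob_def dim flip: exp_add)
  finally show ?thesis .
qed

text \<open>
  On a finite output space pure differential privacy is a condition on single outcomes, since
  the pointwise inequality can be summed over any event.
\<close>

lemma pure_dp_point_measure:
  assumes fin: "finite Y" and nonneg: "\<And>\<theta> k. 0 \<le> p \<theta> k"
    and total: "\<And>\<theta>. \<theta> \<in> \<Theta> \<Longrightarrow> (\<Sum>k\<in>Y. p \<theta> k) = 1"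
    and ratio: "\<And>\<theta> \<theta>' k. \<theta> \<in> \<Theta> \<Longrightarrow> \<theta>' \<in> \<Theta> \<Longrightarrow> adj \<theta> \<theta>' \<Longrightarrow> k \<in> Y \<Longrightarrow> p \<theta> k \<le> exp \<epsilon> * p \<theta>' k"
  shows "pure_dp \<Theta> adj (count_space Y) (\<lambda>\<theta>. point_measure Y (\<lambda>k. ennreal (p \<theta> k))) \<epsilon>"
  unfolding pure_dp_def
proof (intro conjI ballI impI)
  fix \<theta> assume "\<theta> \<in> \<Theta>"
  then have "emeasure (point_measure Y (\<lambda>k. ennreal (p \<theta> k))) Y = 1"
    using fin nonneg total by (simp add: emeasure_point_measure_finite)
  then have "prob_space (point_measure Y (\<lambda>k. ennreal (p \<theta> k)))"
    by (intro prob_spaceI) (simp add: space_point_measure)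
  then show "point_measure Y (\<lambda>k. ennreal (p \<theta> k)) \<in> space (prob_algebra (count_space Y))"
    by (simp add: space_prob_algebra sets_point_measure)
next
  fix \<theta> \<theta>' S
  assume \<theta>: "\<theta> \<in> \<Theta>" "\<theta>' \<in> \<Theta>" "adj \<theta> \<theta>'" and "S \<in> sets (count_space Y)"
  then have S: "S \<subseteq> Y" by simp
  have "(\<Sum>k\<in>S. p \<theta> k) \<le> exp \<epsilon> * (\<Sum>k\<in>S. p \<theta>' k)"
    unfolding sum_distrib_left using ratio[OF \<theta>] S by (intro sum_mono) auto
  then show "measure (point_measure Y (\<lambda>k. ennreal (p \<theta> k))) S
      \<le> exp \<epsilon> * measure (point_measure Y (\<lambda>k. ennreal (p \<theta>' k))) S"
    using S fin nonneg by (simp add: measure_point_measure_finite_if)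
qed

section \<open>Privacy of the region selection\<close>

theorem theorem1:
  fixes \<Theta> :: "(real ^ 'm) set"
    and \<rho> :: "real ^ 'm \<Rightarrow> complex mat"
    and U :: "complex mat"
    and W\<^sub>c\<^sub>l :: "real mat" and b\<^sub>c\<^sub>l :: "real vec"
    and n\<^sub>q K :: nat
    and \<Delta>\<^sub>\<theta> \<gamma> \<beta> L\<^sub>e\<^sub>n\<^sub>c :: real
  assumes "\<Delta>\<^sub>\<theta> > 0" and "0 < \<gamma>" and "\<gamma> < 1" and "\<beta> > 0"
    and "K \<ge> 1"
    and "W\<^sub>c\<^sub>l \<in> carrier_mat K n\<^sub>q" and "b\<^sub>c\<^sub>l \<in> carrier_vec K"
    and "unitary_mat (2 ^ n\<^sub>q) U"
    and "\<And>\<theta>. \<theta> \<in> \<Theta> \<Longrightarrow> pure_density_mat (2 ^ n\<^sub>q) (\<rho> \<theta>)"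
    and "L\<^sub>e\<^sub>n\<^sub>c \<ge> 0"
    and "\<And>\<theta> \<theta>'. \<theta> \<in> \<Theta> \<Longrightarrow> \<theta>' \<in> \<Theta> \<Longrightarrow>
           trace_distance (\<rho> \<theta>) (\<rho> \<theta>') \<le> L\<^sub>e\<^sub>n\<^sub>c * norm (\<theta> - \<theta>')"
  shows "\<exists>\<epsilon>\<^sub>r\<^sub>e\<^sub>g. 0 \<le> \<epsilon>\<^sub>r\<^sub>e\<^sub>g \<and>
           \<epsilon>\<^sub>r\<^sub>e\<^sub>g \<le> 4 * \<beta> * (1 - \<gamma>) * L\<^sub>e\<^sub>n\<^sub>c * \<Delta>\<^sub>\<theta> * norm_inf_1 W\<^sub>c\<^sub>l \<and>
           pure_dp \<Theta> (adjacent \<Delta>\<^sub>\<theta>) (count_space {1..K})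
             (region_mechanism n\<^sub>q K \<gamma> \<beta> U W\<^sub>c\<^sub>l b\<^sub>c\<^sub>l \<rho>) \<epsilon>\<^sub>r\<^sub>e\<^sub>g"
proof (intro exI conjI)
  let ?\<delta> = "2 * (1 - \<gamma>) * (L\<^sub>e\<^sub>n\<^sub>c * \<Delta>\<^sub>\<theta>)"
  let ?\<eta> = "norm_inf_1 W\<^sub>c\<^sub>l * ?\<delta>"
  let ?s = "\<lambda>\<theta>. logits W\<^sub>c\<^sub>l b\<^sub>c\<^sub>l (features n\<^sub>q \<gamma> U (\<rho> \<theta>))"
  have \<delta>: "0 \<le> ?\<delta>"
    using assms(1,3,10) by simp
  have "0 \<le> norm_inf_1 W\<^sub>c\<^sub>l"
    using assms(5,6) by (intro norm_inf_1_nonneg) auto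
  then show "0 \<le> 2 * \<beta> * ?\<eta>"
    using \<delta> assms(4) by simp
  show "2 * \<beta> * ?\<eta> \<le> 4 * \<beta> * (1 - \<gamma>) * L\<^sub>e\<^sub>n\<^sub>c * \<Delta>\<^sub>\<theta> * norm_inf_1 W\<^sub>c\<^sub>l"
    by (simp add: algebra_simps)
  have dim: "dim_vec (?s \<theta>) = K" for \<theta>
    using assms(7) by (simp add: logits_def)
  have logits_close: "\<bar>?s \<theta> $ i - ?s \<theta>' $ i\<bar> \<le> ?\<eta>"
    if \<theta>: "\<theta> \<in> \<Theta>" "\<theta>' \<in> \<Theta>" "adjacent \<Delta>\<^sub>\<theta> \<theta> \<theta>'" and i: "i < K" for \<theta> \<theta>' i
  proof (rule logits_lipschitz[OF assms(6,7) _ _ \<delta> _ i])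
    fix j assume j: "j < n\<^sub>q"
    have states: "\<rho> \<theta> \<in> carrier_mat (2 ^ n\<^sub>q) (2 ^ n\<^sub>q)" "\<rho> \<theta>' \<in> carrier_mat (2 ^ n\<^sub>q) (2 ^ n\<^sub>q)"
      using assms(9) \<theta> by (auto simp: pure_density_mat_def density_mat_def psd_mat_def)
    have "trace_distance (\<rho> \<theta>) (\<rho> \<theta>') \<le> L\<^sub>e\<^sub>n\<^sub>c * norm (\<theta> - \<theta>')"
      using assms(11) \<theta> by blast
    also have "\<dots> \<le> L\<^sub>e\<^sub>n\<^sub>c * \<Delta>\<^sub>\<theta>"
      using \<theta>(3) assms(10) by (intro mult_left_mono) (auto simp: adjacent_def)
    finally have "2 * (1 - \<gamma>) * trace_distance (\<rho> \<theta>) (\<rho> \<theta>') \<le> ?\<delta>"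
      using assms(3) by (intro mult_left_mono) auto
    with features_lipschitz[OF assms(8) less_imp_le[OF assms(3)] j states]
    show "\<bar>features n\<^sub>q \<gamma> U (\<rho> \<theta>) $ j - features n\<^sub>q \<gamma> U (\<rho> \<theta>') $ j\<bar> \<le> ?\<delta>"
      by (rule order.trans)
  qed (auto simp: features_def)
  show "pure_dp \<Theta> (adjacent \<Delta>\<^sub>\<theta>) (count_space {1..K})
      (region_mechanism n\<^sub>q K \<gamma> \<beta> U W\<^sub>c\<^sub>l b\<^sub>c\<^sub>l \<rho>) (2 * \<beta> * ?\<eta>)"
    unfolding region_mechanism_def[abs_def]
  proof (rule pure_dp_point_measure)
    show "(\<Sum>k\<in>{1..K}. softmax_prob \<beta> (?s \<theta>) k) = 1" for \<theta>
      using sum_softmax_prob[of "?s \<theta>" \<beta>] assms(5) unfolding dim by blast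
    show "softmax_prob \<beta> (?s \<theta>) k \<le> exp (2 * \<beta> * ?\<eta>) * softmax_prob \<beta> (?s \<theta>') k"
      if "\<theta> \<in> \<Theta>" "\<theta>' \<in> \<Theta>" "adjacent \<Delta>\<^sub>\<theta> \<theta> \<theta>'" "k \<in> {1..K}" for \<theta> \<theta>' k
      using assms(4) logits_close[OF that(1-3)] that(4)
      by (intro softmax_prob_ratio[OF dim dim]) auto
  qed (auto simp: softmax_prob_nonneg)
qed

end
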